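(* Let $\Gamma$ be a signed graph in which every connected component contains at least two vertices. Then $\eta(\Gamma)=2c(\Gamma)+p(\Gamma)$ if and only if every connected component of $\Gamma$ is a signed cycle with nullity $2$.
   Context: All graphs are simple and finite. A signed graph $\Gamma=(G,\sigma)$ consists of a simple graph $G$ and a map $\sigma:E(G)\to\{+,-\}$; its adjacency matrix has $(i,j)$-entry $\sigma(v_iv_j)$ if $v_i\sim v_j$ and $0$ otherwise. $\eta(\Gamma)$ denotes the multiplicity of the eigenvalue $0$ of the adjacency matrix. $c(\Gamma)=|E(G)|-|V(G)|+\omega(G)$ is the cyclomatic number ($\omega(G)$ the number of components), and $p(\Gamma)$ is the number of vertices of degree one in $G$. A signed cycle is a signed graph whose underlying graph is a cycle. *)

theory Defs
  imports "Jordan_Normal_Form.Char_Poly" "HOL-Computational_Algebra.Polynomial"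
begin

text \<open>
  Edges are two-element sets of vertices. The two signs are the real numbers \<open>1\<close> and \<open>-1\<close>, so
  that \<open>sign \<Gamma> e\<close> is itself the matrix entry; values of \<open>sign \<Gamma>\<close> outside \<open>edges \<Gamma>\<close> are never used.
\<close>

record 'v sgraph =
  verts :: "'v set"
  edges :: "'v set set"
  sign :: "'v set \<Rightarrow> real"

definition signed_graph :: "'v sgraph \<Rightarrow> bool" where
  "signed_graph \<Gamma> \<longleftrightarrow>
     finite (verts \<Gamma>) \<and>
     (\<forall>e \<in> edges \<Gamma>. e \<subseteq> verts \<Gamma> \<and> card e = 2) \<and>
     (\<forall>e \<in> edges \<Gamma>. sign \<Gamma> e = 1 \<or> sign \<Gamma> e = -1)"

definition adj_mat_of :: "'v sgraph \<Rightarrow> 'v list \<Rightarrow> real mat" where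
  "adj_mat_of \<Gamma> vs =
     mat (length vs) (length vs)
       (\<lambda>(i, j). if {vs ! i, vs ! j} \<in> edges \<Gamma> then sign \<Gamma> {vs ! i, vs ! j} else 0)"

text \<open>
  A fixed enumeration of the vertices. Any other enumeration conjugates the adjacency matrix by a
  permutation matrix and so leaves the characteristic polynomial unchanged.
\<close>

definition vertex_list :: "'v sgraph \<Rightarrow> 'v list" where
  "vertex_list \<Gamma> = (SOME vs. distinct vs \<and> set vs = verts \<Gamma>)"

definition adj_mat :: "'v sgraph \<Rightarrow> real mat" where
  "adj_mat \<Gamma> = adj_mat_of \<Gamma> (vertex_list \<Gamma>)"

definition nullity :: "'v sgraph \<Rightarrow> nat" where
  "nullity \<Gamma> = order 0 (char_poly (adj_mat \<Gamma>))"

definition reachable :: "'v sgraph \<Rightarrow> ('v \<times> 'v) set" where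
  "reachable \<Gamma> =
     {(u, v). u \<in> verts \<Gamma> \<and> v \<in> verts \<Gamma> \<and> (u, v) \<in> {(x, y). {x, y} \<in> edges \<Gamma>}\<^sup>*}"

definition induced :: "'v sgraph \<Rightarrow> 'v set \<Rightarrow> 'v sgraph" where
  "induced \<Gamma> C = \<lparr>verts = C, edges = {e \<in> edges \<Gamma>. e \<subseteq> C}, sign = sign \<Gamma>\<rparr>"

definition components :: "'v sgraph \<Rightarrow> 'v sgraph set" where
  "components \<Gamma> = induced \<Gamma> ` (verts \<Gamma> // reachable \<Gamma>)"

definition cyclomatic :: "'v sgraph \<Rightarrow> int" where
  "cyclomatic \<Gamma> = int (card (edges \<Gamma>)) - int (card (verts \<Gamma>)) + int (card (components \<Gamma>))"

definition degree_of :: "'v sgraph \<Rightarrow> 'v \<Rightarrow> nat" where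
  "degree_of \<Gamma> v = card {e \<in> edges \<Gamma>. v \<in> e}"

definition num_pendant :: "'v sgraph \<Rightarrow> nat" where
  "num_pendant \<Gamma> = card {v \<in> verts \<Gamma>. degree_of \<Gamma> v = 1}"

definition signed_cycle :: "'v sgraph \<Rightarrow> bool" where
  "signed_cycle \<Gamma> \<longleftrightarrow> signed_graph \<Gamma> \<and>
     (\<exists>vs. length vs \<ge> 3 \<and> distinct vs \<and> verts \<Gamma> = set vs \<and>
        edges \<Gamma> = {{vs ! i, vs ! (Suc i mod length vs)} | i. i < length vs})"

end

theory Submission
  imports Defs "Jordan_Normal_Form.Jordan_Normal_Form_Existence"
    "Jordan_Normal_Form.Jordan_Normal_Form_Uniqueness"
begin

text \<open>
  Both sides are additive over components, so let \<open>\<Gamma>\<close> be connected. The adjacency matrix is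
  symmetric, so the nullity is the dimension of its kernel, which is at most \<open>|Z|\<close> whenever a
  kernel vector vanishing on \<open>Z\<close> must be zero. Fix a spanning tree with root \<open>r\<close>. The kernel
  equation at a vertex \<open>w \<noteq> r\<close> expresses the value at the parent of \<open>w\<close> through the children of
  \<open>w\<close> and the nontree neighbours of \<open>w\<close>. Hence it suffices that \<open>Z\<close> contains the nonroot leaves of
  the tree and the far ends of the nontree edges at nonroot vertices. There are \<open>c\<close> nontree edges,
  and a tree leaf that is not pendant in \<open>\<Gamma>\<close> lies on one of them, so \<open>\<eta> \<le> 2c + p\<close>.

  If there is a pendant vertex, take it as the root and omit it from \<open>Z\<close>. If there is none but an
  edge \<open>{r, s}\<close> of some cycle has \<open>deg s \<ge> 3\<close>, choose the tree to avoid this edge and root it at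
  \<open>r\<close>; then \<open>s\<close> need not be put into \<open>Z\<close> on account of it. In both cases the bound is strict.
  Otherwise every vertex of a cycle has degree 2, and \<open>\<Gamma>\<close> is that cycle.
\<close>

subsection \<open>Nullity of symmetric matrices and of block matrices\<close>

text \<open>If the kernel had dimension above \<open>card Z\<close>, vanishing on \<open>Z\<close>
  would impose fewer linear conditions than there are basis vectors, so some nontrivial combination
  of them would vanish on \<open>Z\<close>.\<close>

lemma kernel_dim_le_card:
  fixes A :: "'a :: field mat"
  assumes A: "A \<in> carrier_mat nr nc"
    and Z: "Z \<subseteq> {..<nc}"
    and vanish: "\<And>v. v \<in> mat_kernel A \<Longrightarrow> (\<And>i. i \<in> Z \<Longrightarrow> v $ i = 0) \<Longrightarrow> v = 0\<^sub>v nc"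
  shows "kernel_dim A \<le> card Z"
proof (rule ccontr)
  interpret kernel nr nc A by unfold_locales (rule A)
  assume "\<not> kernel_dim A \<le> card Z"
  hence less: "card Z < dim" by simp
  from kernel_basis_exists[OF A] obtain b where fin: "finite b" and basis: "basis b" by auto
  have card_b: "card b = dim" using Ker.dim_basis[OF fin basis] by simp
  have b_ker: "b \<subseteq> mat_kernel A" and indep: "\<not> lin_dep b"
    using basis unfolding Ker.basis_def by auto
  define k where "k = card b"
  have finZ: "finite Z" using Z finite_subset by blast
  obtain bs where bs: "set bs = b" "distinct bs" using finite_distinct_list[OF fin] by blast
  obtain zs where zs: "set zs = Z" "distinct zs" using finite_distinct_list[OF finZ] by blast
  have len: "length bs = k" "length zs = card Z"
    using distinct_card[OF bs(2)] distinct_card[OF zs(2)] bs zs k_def by auto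
  \<comment> \<open>Zero rows pad the \<open>card Z\<close> conditions to a square system, so that a
    vanishing determinant yields a nontrivial solution.\<close>
  define M where "M = mat k k (\<lambda>(i, j). if i < card Z then (bs ! j) $ (zs ! i) else 0)"
  have M: "M \<in> carrier_mat k k" unfolding M_def by simp
  have "card Z < k" using less card_b k_def by simp
  have "M = mat\<^sub>r k k (\<lambda>i. if i = card Z then 0\<^sub>v k else row M i)"
    by (rule eq_matI) (auto simp: M_def)
  moreover have "det \<dots> = 0"
    using \<open>card Z < k\<close> M by (intro det_row_0) auto
  ultimately have "det M = 0" by simp
  then obtain v where v: "v \<in> carrier_vec k" "v \<noteq> 0\<^sub>v k" "M *\<^sub>v v = 0\<^sub>v k"
    using det_0_iff_vec_prod_zero_field[OF M] by blast
  \<comment> \<open>\<open>lincomb\<close> takes coefficients indexed by the basis vectors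
    themselves, hence the translation from positions in \<open>bs\<close>.\<close>
  define a where "a w = v $ (THE j. j < k \<and> bs ! j = w)" for w
  have a_bs: "a (bs ! j) = v $ j" if "j < k" for j
  proof -
    have "(THE i. i < k \<and> bs ! i = bs ! j) = j"
      using that bs(2) len by (auto simp: nth_eq_iff_index_eq)
    thus ?thesis by (simp add: a_def)
  qed
  have bij: "bij_betw (\<lambda>j. bs ! j) {..<k} b"
    using bij_betw_nth[OF bs(2)] bs len by auto
  have idx: "lincomb a b $ i = (\<Sum>j<k. v $ j * (bs ! j) $ i)" if "i < nc" for i
  proof -
    have "lincomb a b $ i = (\<Sum>w\<in>b. a w * w $ i)"
      by (rule lincomb_index[OF that b_ker])
    also have "\<dots> = (\<Sum>j<k. v $ j * (bs ! j) $ i)"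
      by (subst sum.reindex_bij_betw[OF bij, symmetric]) (simp add: a_bs)
    finally show ?thesis .
  qed
  have ker: "lincomb a b \<in> mat_kernel A"
    using Ker.lincomb_closed[OF b_ker, of a] by auto
  have "lincomb a b $ z = 0" if z: "z \<in> Z" for z
  proof -
    obtain i where i: "i < card Z" "zs ! i = z" 
      using z[folded zs(1)] unfolding in_set_conv_nth len(2) by blast
    have ik: "i < k" using i \<open>card Z < k\<close> by simp
    have "0 = (M *\<^sub>v v) $ i" using v ik by simp
    also have "\<dots> = (\<Sum>j<k. (bs ! j) $ z * v $ j)"
      using ik v(1) i by (simp add: M_def scalar_prod_def atLeast0LessThan)
    finally show ?thesis using idx[of z] z Z by (auto simp: mult.commute)
  qed
  from vanish[OF ker this] have zero: "lincomb a b = 0\<^sub>v nc" by blast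
  obtain j where j: "j < k" "v $ j \<noteq> 0"
    using v(1,2) by (metis carrier_vecD eq_vecI index_zero_vec(1) index_zero_vec(2))
  have "lin_dep b" unfolding Ker.lin_dep_def
    by (intro exI[of _ b] exI[of _ a] exI[of _ "bs ! j"])
      (use fin zero a_bs[OF j(1)] j bs len in auto)
  with indep show False ..
qed

text \<open>Symmetry makes the kernels of the matrix and of its square agree, so every Jordan block
  for 0 has size 1. The number of these blocks is the kernel dimension, their total size the
  algebraic multiplicity. Over the complex numbers the characteristic polynomial splits.\<close>

lemma order_char_poly_real_symmetric:
  fixes A :: "real mat"
  assumes A: "A \<in> carrier_mat n n"
    and sym: "\<And>i j. i < n \<Longrightarrow> j < n \<Longrightarrow> A $$ (i, j) = A $$ (j, i)"
  shows "Polynomial.order 0 (char_poly A) = kernel_dim (map_mat complex_of_real A)"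
proof -
  define B where "B = map_mat complex_of_real A"
  have B: "B \<in> carrier_mat n n" using A by (simp add: B_def)
  have entry: "B $$ (i, j) = of_real (A $$ (i, j))" if "i < n" "j < n" for i j
    using that A by (simp add: B_def)
  have Bv: "(B *\<^sub>v v) $ i = (\<Sum>j<n. of_real (A $$ (i, j)) * v $ j)"
    if "v \<in> carrier_vec n" "i < n" for v i
    using that B entry by (simp add: scalar_prod_def atLeast0LessThan)
  have BB: "B * B \<in> carrier_mat n n" using B by simp
  have kernel_square: "mat_kernel (B * B) = mat_kernel B"
  proof
    show "mat_kernel B \<subseteq> mat_kernel (B * B)" by (rule mat_kernel_mult_subset[OF B B])
    show "mat_kernel (B * B) \<subseteq> mat_kernel B"
    proof
      fix v assume "v \<in> mat_kernel (B * B)"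
      from mat_kernelD[OF BB this] have v: "v \<in> carrier_vec n" and "B * B *\<^sub>v v = 0\<^sub>v n" by auto
      define w where "w = B *\<^sub>v v"
      have w: "w \<in> carrier_vec n" using B v by (simp add: w_def)
      have Bw: "B *\<^sub>v w = 0\<^sub>v n"
        using \<open>B * B *\<^sub>v v = 0\<^sub>v n\<close> B v by (simp add: w_def)
      \<comment> \<open>The squared norm of \<open>w = B v\<close> equals the pairing of
        \<open>v\<close> with \<open>B w\<close>, since \<open>A\<close> is real and symmetric; the
        latter is 0.\<close>
      have "(\<Sum>i<n. cnj (w $ i) * w $ i)
          = (\<Sum>i<n. \<Sum>j<n. cnj (v $ j) * (of_real (A $$ (i, j)) * w $ i))"
        using v by (simp add: w_def Bv sum_distrib_right sum_distrib_left mult_ac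
            del: index_mult_mat_vec)
      also have "\<dots> = (\<Sum>j<n. cnj (v $ j) * (\<Sum>i<n. of_real (A $$ (j, i)) * w $ i))"
        by (subst sum.swap) (simp add: sum_distrib_left sym)
      also have "\<dots> = (\<Sum>j<n. cnj (v $ j) * (B *\<^sub>v w) $ j)"
        using w by (simp add: Bv del: index_mult_mat_vec)
      also have "\<dots> = 0" unfolding Bw by simp
      finally have "complex_of_real (\<Sum>i<n. (cmod (w $ i))\<^sup>2) = 0"
        unfolding of_real_sum complex_norm_square by (simp add: mult.commute)
      hence "\<forall>i<n. (cmod (w $ i))\<^sup>2 = 0"
        by (subst (asm) of_real_eq_0_iff, subst (asm) sum_nonneg_eq_0_iff) auto
      hence "w = 0\<^sub>v n" using w by (intro eq_vecI) auto
      thus "v \<in> mat_kernel B" using v by (intro mat_kernelI[OF B]) (auto simp: w_def)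
    qed
  qed
  obtain as where "char_poly B = (\<Prod>a\<leftarrow>as. [:- a, 1:])" using char_poly_factorized[OF B] by auto
  from jordan_nf_exists[OF B this] obtain n_as where jnf: "jordan_nf B n_as" ..
  have char: "char_matrix B 0 = B" using B by (intro eq_matI) (auto simp: char_matrix_def)
  have "B ^\<^sub>m 1 = B" "B ^\<^sub>m 2 = B * B" using B by (auto simp: numeral_2_eq_2)
  hence dims: "dim_gen_eigenspace B 0 1 = kernel_dim B" "dim_gen_eigenspace B 0 2 = kernel_dim B"
    using B unfolding dim_gen_eigenspace_def char by (auto simp: kernel_dim_def kernel_square)
  \<comment> \<open>These are the sizes of the blocks for 0. The generalized eigenspaces of orders 1
    and 2 have as dimensions the sums of \<open>min 1 n\<close> and \<open>min 2 n\<close>; their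
    equality rules out sizes above 1.\<close>
  define ns where "ns = map fst [(n, e)\<leftarrow>n_as. e = 0]"
  have "(\<Sum>n\<leftarrow>ns. min 1 n) = (\<Sum>n\<leftarrow>ns. min 2 n)"
    using dims dim_gen_eigenspace[OF jnf, of 0] unfolding ns_def by metis
  moreover have "(\<Sum>n\<leftarrow>ns. min 1 n) = (\<Sum>n\<leftarrow>ns. min 2 n) \<Longrightarrow> (\<Sum>n\<leftarrow>ns. min 1 n) = sum_list ns" for ns :: "nat list"
  proof (induction ns)
    case (Cons n ns)
    have "(\<Sum>n\<leftarrow>ns. min 1 n) \<le> (\<Sum>n\<leftarrow>ns. min 2 n)"
      by (rule sum_list_mono) auto
    with Cons show ?case by (auto simp: min_def split: if_splits)
  qed simp
  ultimately have "kernel_dim B = sum_list ns"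
    using dims dim_gen_eigenspace[OF jnf, of 0 1] unfolding ns_def by metis
  also have "\<dots> = Polynomial.order 0 (char_poly B)"
    unfolding jordan_nf_order[OF jnf] ns_def by (simp add: case_prod_beta')
  also have "char_poly B = map_poly complex_of_real (char_poly A)"
    unfolding B_def by (rule of_real_hom.char_poly_hom[OF A])
  also have "Polynomial.order 0 \<dots> = Polynomial.order 0 (char_poly A)"
  proof -
    interpret map_poly_inj_idom_divide_hom complex_of_real ..
    show ?thesis using order_hom[of 0 "char_poly A"] by simp
  qed
  finally show ?thesis by (simp add: B_def)
qed

lemma char_poly_block_diagonal:
  fixes A B :: "'a :: idom mat"
  assumes A: "A \<in> carrier_mat n n" and B: "B \<in> carrier_mat m m"
  shows "char_poly (four_block_mat A (0\<^sub>m n m) (0\<^sub>m m n) B) = char_poly A * char_poly B"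
proof -
  have "char_poly_matrix (four_block_mat A (0\<^sub>m n m) (0\<^sub>m m n) B)
      = four_block_mat (char_poly_matrix A) (0\<^sub>m n m) (0\<^sub>m m n) (char_poly_matrix B)"
    by (rule eq_matI) (use A B in \<open>auto simp: char_poly_matrix_def\<close>)
  thus ?thesis unfolding char_poly_def
    by (simp add: det_four_block_mat_lower_left_zero[OF _ zero_carrier_mat refl]
        char_poly_matrix_closed[OF A] char_poly_matrix_closed[OF B])
qed

lemma det_permute_rows_cols:
  fixes A :: "'a :: comm_ring_1 mat"
  assumes A: "A \<in> carrier_mat n n" and p: "p permutes {0..<n}"
  shows "det (mat n n (\<lambda>(i, j). A $$ (p i, p j))) = det A"
proof -
  define D where "D = mat n n (\<lambda>(i, j). A $$ (i, p j))"
  have D: "D \<in> carrier_mat n n" by (simp add: D_def)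
  have p_less: "p i < n" if "i < n" for i using permutes_in_image[OF p, of i] that by simp
  have "mat n n (\<lambda>(i, j). A $$ (p i, p j)) = mat n n (\<lambda>(i, j). D $$ (p i, j))"
    by (rule eq_matI) (auto simp: D_def p_less)
  hence "det (mat n n (\<lambda>(i, j). A $$ (p i, p j))) = signof p * det D"
    using det_permute_rows[OF D p] by simp
  also have "det D = det (transpose_mat D)" using det_transpose[OF D] by simp
  also have "transpose_mat D = mat n n (\<lambda>(i, j). transpose_mat A $$ (p i, j))"
    by (rule eq_matI) (use A in \<open>auto simp: D_def p_less\<close>)
  also have "det \<dots> = signof p * det A"
    using det_permute_rows[of "transpose_mat A", OF _ p] A det_transpose[OF A] by simp
  also have "signof p * (signof p * det A) = det A" by (auto simp: Permutations.sign_def)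
  finally show ?thesis .
qed

section \<open>Adjacency matrices and the nullity of disjoint unions\<close>

lemma adj_mat_of_carrier: "adj_mat_of \<Gamma> vs \<in> carrier_mat (length vs) (length vs)"
  by (simp add: adj_mat_of_def)

lemma char_poly_adj_mat_of_cong:
  assumes "distinct vs" "distinct ws" "set vs = set ws"
  shows "char_poly (adj_mat_of \<Gamma> vs) = char_poly (adj_mat_of \<Gamma> ws)"
proof -
  have "mset vs = mset ws" using assms by (simp add: set_eq_iff_mset_eq_distinct)
  then obtain p where p: "p permutes {..<length ws}" "permute_list p ws = vs"
    by (rule mset_eq_permutation)
  define n where "n = length ws"
  have len: "length vs = n" using p(2) n_def by auto
  have p': "p permutes {0..<n}" using p(1) by (simp add: n_def atLeast0LessThan)
  have nth: "vs ! i = ws ! p i" if "i < n" for i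
    using permute_list_nth[OF p(1)] that p(2) n_def by auto
  have p_less: "p i < n" if "i < n" for i using permutes_in_image[OF p', of i] that by simp
  have p_inj: "p i = p j \<longleftrightarrow> i = j" for i j using permutes_inj[OF p'] by (auto dest: injD)
  have C: "char_poly_matrix (adj_mat_of \<Gamma> ws) \<in> carrier_mat n n"
    using adj_mat_of_carrier[of \<Gamma> ws] n_def by simp
  have "char_poly_matrix (adj_mat_of \<Gamma> vs)
      = mat n n (\<lambda>(i, j). char_poly_matrix (adj_mat_of \<Gamma> ws) $$ (p i, p j))"
    by (rule eq_matI) (auto simp: char_poly_matrix_def adj_mat_of_def len nth p_less p_inj
        n_def[symmetric])
  thus ?thesis unfolding char_poly_def using det_permute_rows_cols[OF C p'] by simp
qed

lemma vertex_list:
  assumes "finite (verts \<Gamma>)"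
  shows "distinct (vertex_list \<Gamma>)" "set (vertex_list \<Gamma>) = verts \<Gamma>"
proof -
  have "\<exists>vs. distinct vs \<and> set vs = verts \<Gamma>" using finite_distinct_list[OF assms] by blast
  hence "distinct (vertex_list \<Gamma>) \<and> set (vertex_list \<Gamma>) = verts \<Gamma>"
    unfolding vertex_list_def by (rule someI_ex)
  thus "distinct (vertex_list \<Gamma>)" "set (vertex_list \<Gamma>) = verts \<Gamma>" by auto
qed

text \<open>This frees \<open>nullity\<close> from the enumeration picked by \<open>SOME\<close>:
  later proofs may list the vertices in a convenient order.\<close>

lemma nullity_eq_order:
  assumes "distinct vs" "set vs = verts \<Gamma>"
  shows "nullity \<Gamma> = Polynomial.order 0 (char_poly (adj_mat_of \<Gamma> vs))"
proof -
  have "finite (verts \<Gamma>)" using assms(2) by (metis finite_set)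
  from vertex_list[OF this] assms show ?thesis
    unfolding nullity_def adj_mat_def by (metis char_poly_adj_mat_of_cong)
qed

lemma adj_mat_of_induced:
  assumes "set vs \<subseteq> C"
  shows "adj_mat_of (induced \<Gamma> C) vs = adj_mat_of \<Gamma> vs"
proof -
  have "vs ! i \<in> C" if "i < length vs" for i using assms that by auto
  thus ?thesis by (auto simp: adj_mat_of_def induced_def intro!: eq_matI)
qed

text \<open>Listing \<open>A\<close> before \<open>B\<close> makes the adjacency matrix block
  diagonal. The characteristic polynomials multiply, and the order of a root is additive on nonzero
  polynomials.\<close>

lemma nullity_induced_Un:
  assumes "finite A" "finite B" "A \<inter> B = {}"
    and no_edge: "\<And>a b. a \<in> A \<Longrightarrow> b \<in> B \<Longrightarrow> {a, b} \<notin> edges \<Gamma>"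
  shows "nullity (induced \<Gamma> (A \<union> B)) = nullity (induced \<Gamma> A) + nullity (induced \<Gamma> B)"
proof -
  obtain as where as: "set as = A" "distinct as" using finite_distinct_list[OF assms(1)] by blast
  obtain bs where bs: "set bs = B" "distinct bs" using finite_distinct_list[OF assms(2)] by blast
  let ?n = "length as" and ?m = "length bs"
  have nA: "as ! i \<in> A" if "i < ?n" for i using that as by auto
  have nB: "bs ! i \<in> B" if "i < ?m" for i using that bs by auto
  have "adj_mat_of \<Gamma> (as @ bs) = four_block_mat (adj_mat_of \<Gamma> as) (0\<^sub>m ?n ?m) (0\<^sub>m ?m ?n) (adj_mat_of \<Gamma> bs)"
    by (rule eq_matI)
      (auto simp: adj_mat_of_def nth_append no_edge nA nB insert_commute[of "bs ! _" "as ! _"])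
  hence "char_poly (adj_mat_of \<Gamma> (as @ bs)) = char_poly (adj_mat_of \<Gamma> as) * char_poly (adj_mat_of \<Gamma> bs)"
    using char_poly_block_diagonal[OF adj_mat_of_carrier adj_mat_of_carrier] by metis
  moreover have "char_poly (adj_mat_of \<Gamma> vs) \<noteq> 0" for vs
    using degree_monic_char_poly[OF adj_mat_of_carrier, of \<Gamma> vs] by auto
  moreover have null: "nullity (induced \<Gamma> C) = Polynomial.order 0 (char_poly (adj_mat_of \<Gamma> vs))"
    if "distinct vs" "set vs = C" for C vs
    using nullity_eq_order[of vs "induced \<Gamma> C"] that adj_mat_of_induced[of vs C \<Gamma>]
    by (simp add: induced_def)
  ultimately show ?thesis
    using as bs assms(3) null[of "as @ bs" "A \<union> B"] null[of as A] null[of bs B]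
    by (simp add: order_mult)
qed

lemma nullity_induced_Union:
  assumes "finite \<C>" "\<And>C. C \<in> \<C> \<Longrightarrow> finite C"
    and "disjoint \<C>"
    and no_edge: "\<And>C D a b. C \<in> \<C> \<Longrightarrow> D \<in> \<C> \<Longrightarrow> C \<noteq> D \<Longrightarrow> a \<in> C \<Longrightarrow> b \<in> D \<Longrightarrow> {a, b} \<notin> edges \<Gamma>"
  shows "nullity (induced \<Gamma> (\<Union>\<C>)) = (\<Sum>C\<in>\<C>. nullity (induced \<Gamma> C))"
  using assms
proof (induction \<C> rule: finite_induct)
  case empty
  \<comment> \<open>The empty matrix has characteristic polynomial 1, whose order at 0 is 0,
    matching the empty sum.\<close>
  have "adj_mat_of (induced \<Gamma> {}) [] \<in> carrier_mat 0 0" by (simp add: adj_mat_of_def)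
  hence "char_poly (adj_mat_of (induced \<Gamma> {}) []) = 1"
    unfolding char_poly_def using char_poly_matrix_closed by (metis det_dim_zero)
  thus ?case using nullity_eq_order[of "[]" "induced \<Gamma> {}"] by (simp add: induced_def)
next
  case (insert C \<C>)
  have "C \<inter> \<Union>\<C> = {}" using insert.hyps insert.prems(2) by (auto simp: disjoint_def)
  moreover have "disjoint \<C>" using insert.prems(2) by (auto simp: disjoint_def)
  moreover have "{a, b} \<notin> edges \<Gamma>" if "a \<in> C" "b \<in> \<Union>\<C>" for a b
    using that insert.prems(3)[of C _ a b] insert.hyps by auto
  moreover have "nullity (induced \<Gamma> (\<Union>\<C>)) = (\<Sum>C\<in>\<C>. nullity (induced \<Gamma> C))"
    by (rule insert.IH) (use insert.prems \<open>disjoint \<C>\<close> in blast)+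
  ultimately show ?case
    using insert.hyps insert.prems(1) nullity_induced_Un[of C "\<Union>\<C>" \<Gamma>] by simp
qed

text \<open>Over the complex numbers because the multiplicity of the root 0 is read off a Jordan normal form.\<close>

lemma nullity_le_card:
  fixes \<Gamma> :: "'v sgraph"
  assumes \<Gamma>: "signed_graph \<Gamma>" and Z: "Z \<subseteq> verts \<Gamma>"
    and forces: "\<And>x :: 'v \<Rightarrow> complex. \<lbrakk>\<And>w. w \<in> verts \<Gamma> \<Longrightarrow>
      (\<Sum>u \<in> {u \<in> verts \<Gamma>. {w, u} \<in> edges \<Gamma>}. complex_of_real (sign \<Gamma> {w, u}) * x u) = 0;
      \<And>z. z \<in> Z \<Longrightarrow> x z = 0\<rbrakk> \<Longrightarrow> \<forall>v \<in> verts \<Gamma>. x v = 0"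
  shows "nullity \<Gamma> \<le> card Z"
proof -
  have fin: "finite (verts \<Gamma>)" using \<Gamma> by (simp add: signed_graph_def)
  obtain vs where vs: "set vs = verts \<Gamma>" "distinct vs" using finite_distinct_list[OF fin] by blast
  define n where "n = length vs"
  define A where "A = adj_mat_of \<Gamma> vs"
  define B where "B = map_mat complex_of_real A"
  have A: "A \<in> carrier_mat n n" unfolding A_def n_def by (rule adj_mat_of_carrier)
  have B: "B \<in> carrier_mat n n" using A by (simp add: B_def)
  have sym: "A $$ (i, j) = A $$ (j, i)" if "i < n" "j < n" for i j
    using that by (simp add: A_def adj_mat_of_def n_def insert_commute)
  have bij: "bij_betw (\<lambda>j. vs ! j) {..<n} (verts \<Gamma>)"
    using bij_betw_nth[OF vs(2)] vs(1) n_def by auto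
  \<comment> \<open>\<open>ix\<close> inverts the enumeration, so that a kernel vector
    \<open>y\<close> becomes the function \<open>y $ ix v\<close> of a vertex
    \<open>v\<close>.\<close>
  define ix where "ix = the_inv_into {..<n} (\<lambda>j. vs ! j)"
  have ix_nth: "ix (vs ! i) = i" if "i < n" for i
    unfolding ix_def using bij that by (intro the_inv_into_f_f) (auto simp: bij_betw_def)
  have bij_ix: "bij_betw ix (verts \<Gamma>) {..<n}"
    unfolding ix_def by (rule bij_betw_the_inv_into[OF bij])
  have nth_ix: "vs ! ix v = v" if "v \<in> verts \<Gamma>" for v
    using bij that ix_nth by (metis bij_betw_iff_bijections lessThan_iff)
  have "kernel_dim B \<le> card (ix ` Z)"
  proof (rule kernel_dim_le_card[OF B])
    show "ix ` Z \<subseteq> {..<n}" using bij_ix Z by (auto simp: bij_betw_def)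
    fix y assume y: "y \<in> mat_kernel B" and y0: "\<And>i. i \<in> ix ` Z \<Longrightarrow> y $ i = 0"
    from mat_kernelD[OF B y] have yc: "y \<in> carrier_vec n" and By: "B *\<^sub>v y = 0\<^sub>v n" by auto
    have "\<forall>v \<in> verts \<Gamma>. y $ ix v = 0"
    proof (rule forces)
      fix w assume w: "w \<in> verts \<Gamma>"
      define i where "i = ix w"
      have i: "i < n" "vs ! i = w" using w bij_ix nth_ix by (auto simp: i_def bij_betw_def)
      let ?a = "\<lambda>u. if {w, u} \<in> edges \<Gamma> then complex_of_real (sign \<Gamma> {w, u}) else 0"
      have "0 = (B *\<^sub>v y) $ i" using By i by simp
      also have "\<dots> = (\<Sum>j<n. ?a (vs ! j) * y $ ix (vs ! j))"
        using i yc A B by (auto simp: scalar_prod_def atLeast0LessThan B_def A_def adj_mat_of_def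
            n_def[symmetric] ix_nth intro!: sum.cong)
      also have "\<dots> = (\<Sum>u\<in>verts \<Gamma>. ?a u * y $ ix u)"
        by (rule sum.reindex_bij_betw[OF bij, of "\<lambda>u. ?a u * y $ ix u"])
      also have "\<dots> = (\<Sum>u \<in> {u \<in> verts \<Gamma>. {w, u} \<in> edges \<Gamma>}. complex_of_real (sign \<Gamma> {w, u}) * y $ ix u)"
        using fin by (intro sum.mono_neutral_cong_right) auto
      finally show "(\<Sum>u \<in> {u \<in> verts \<Gamma>. {w, u} \<in> edges \<Gamma>}. complex_of_real (sign \<Gamma> {w, u}) * y $ ix u) = 0"
        by simp
    next
      fix z assume "z \<in> Z" thus "y $ ix z = 0" by (intro y0) auto
    qed
    hence "y $ i = 0" if "i < n" for i
      using that ix_nth bij by (metis bij_betwE lessThan_iff)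
    thus "y = 0\<^sub>v n" using yc by (intro eq_vecI) auto
  qed
  also have "card (ix ` Z) \<le> card Z" using Z fin by (intro card_image_le) (auto dest: finite_subset)
  also have "kernel_dim B = nullity \<Gamma>"
    using order_char_poly_real_symmetric[OF A sym] nullity_eq_order[OF vs(2,1)] by (simp add: A_def B_def)
  finally show ?thesis .
qed

subsection \<open>Rooted spanning trees\<close>

definition adjacency :: "'v set set \<Rightarrow> ('v \<times> 'v) set" where
  "adjacency E = {(x, y). {x, y} \<in> E}"

lemma sym_adjacency: "sym (adjacency E)"
  by (auto simp: sym_def adjacency_def insert_commute)

text \<open>Vertices and edges are separate arguments, so that the notion applies as well to the
  edges of a tree or to a graph from which an edge was deleted.\<close>

definition connected_on :: "'v set \<Rightarrow> 'v set set \<Rightarrow> bool" where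
  "connected_on V E \<longleftrightarrow> (\<forall>u \<in> V. \<forall>v \<in> V. (u, v) \<in> (adjacency E)\<^sup>*)"

text \<open>A spanning tree is encoded by its parent function; the depth \<open>d\<close> only has to decrease
  towards the root.\<close>

definition spanning_tree :: "'v set \<Rightarrow> 'v set set \<Rightarrow> 'v \<Rightarrow> ('v \<Rightarrow> 'v) \<Rightarrow> ('v \<Rightarrow> nat) \<Rightarrow> bool" where
  "spanning_tree V E r par d \<longleftrightarrow>
     r \<in> V \<and> (\<forall>v \<in> V - {r}. par v \<in> V \<and> {v, par v} \<in> E \<and> d (par v) < d v)"

definition tree_edges :: "'v set \<Rightarrow> 'v \<Rightarrow> ('v \<Rightarrow> 'v) \<Rightarrow> 'v set set" where
  "tree_edges V r par = (\<lambda>v. {v, par v}) ` (V - {r})"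

text \<open>A breadth-first tree: the parent of \<open>v\<close> is the last vertex before
  \<open>v\<close> on a shortest walk from \<open>r\<close>.\<close>

lemma spanning_tree_exists:
  assumes "r \<in> V" and E: "\<And>e. e \<in> E \<Longrightarrow> e \<subseteq> V" and conn: "connected_on V E"
  obtains par d where "spanning_tree V E r par d"
proof -
  define R where "R = adjacency E"
  define d where "d v = (LEAST n. (r, v) \<in> R ^^ n)" for v
  have least: "(r, v) \<in> R ^^ d v" if "v \<in> V" for v
  proof -
    have "(r, v) \<in> R\<^sup>*" using conn assms(1) that by (simp add: connected_on_def R_def)
    hence "\<exists>n. (r, v) \<in> R ^^ n" by (simp add: rtrancl_is_UN_relpow)
    thus ?thesis unfolding d_def by (rule LeastI_ex)
  qed
  have "\<exists>u. u \<in> V \<and> {v, u} \<in> E \<and> d u < d v" if v: "v \<in> V - {r}" for v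
  proof -
    have dv: "(r, v) \<in> R ^^ d v" using least v by blast
    with v have "d v \<noteq> 0" by (metis DiffE insertI1 relpow_0_E)
    then obtain m where m: "d v = Suc m" using not0_implies_Suc by blast
    then obtain u where u: "(r, u) \<in> R ^^ m" "(u, v) \<in> R" using dv by auto
    have "d u \<le> m" unfolding d_def using u(1) by (rule Least_le)
    moreover have e: "{v, u} \<in> E" using u(2) by (simp add: R_def adjacency_def insert_commute)
    ultimately show ?thesis using E[OF e] m by auto
  qed
  then obtain par where "\<forall>v \<in> V - {r}. par v \<in> V \<and> {v, par v} \<in> E \<and> d (par v) < d v" by metis
  thus ?thesis using that[of par d] assms(1) by (simp add: spanning_tree_def)
qed

lemma tree_edges_subset: "spanning_tree V E r par d \<Longrightarrow> tree_edges V r par \<subseteq> E"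
  by (auto simp: spanning_tree_def tree_edges_def)

text \<open>A tree has one edge per nonroot vertex, which leaves as many nontree edges as the
  cyclomatic number of a connected graph.\<close>

lemma card_nontree_edges:
  assumes T: "spanning_tree V E r par d" and fin: "finite V" "finite E"
  shows "int (card (E - tree_edges V r par)) = int (card E) - int (card V) + 1"
proof -
  have "inj_on (\<lambda>v. {v, par v}) (V - {r})"
  proof (rule inj_onI)
    fix v w assume vw: "v \<in> V - {r}" "w \<in> V - {r}" "{v, par v} = {w, par w}"
    show "v = w"
    proof (rule ccontr)
      assume "v \<noteq> w"
      \<comment> \<open>Two vertices that are parents of each other would each have smaller depth
        than the other.\<close>
      hence "v = par w" "w = par v" using vw(3) by (auto simp: doubleton_eq_iff)
      moreover have "d (par v) < d v" "d (par w) < d w" using T vw by (auto simp: spanning_tree_def)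
      ultimately show False by simp
    qed
  qed
  hence "card (tree_edges V r par) = card (V - {r})" unfolding tree_edges_def by (rule card_image)
  also have "int \<dots> = int (card V) - 1"
  proof -
    have "r \<in> V" using T by (simp add: spanning_tree_def)
    hence "card V > 0" using fin by (auto simp: card_gt_0_iff)
    thus ?thesis using \<open>r \<in> V\<close> by (simp add: of_nat_diff)
  qed
  finally have "int (card (tree_edges V r par)) = int (card V) - 1" by simp
  moreover have "card (tree_edges V r par) \<le> card E"
    using card_mono[OF fin(2) tree_edges_subset[OF T]] .
  ultimately show ?thesis
    using card_Diff_subset[OF finite_subset[OF tree_edges_subset[OF T] fin(2)] tree_edges_subset[OF T]]
    by simp
qed

text \<open>A nonroot vertex of least depth can only have the root as its parent. The forcing
  argument relies on this: a childless vertex is never the root.\<close>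

lemma root_has_child:
  assumes T: "spanning_tree V E r par d" and "card V \<ge> 2"
  obtains w where "w \<in> V - {r}" "par w = r"
proof -
  have "V - {r} \<noteq> {}"
  proof
    assume "V - {r} = {}"
    hence "card V \<le> card {r}" by (intro card_mono) auto
    thus False using assms(2) by simp
  qed
  then obtain w where w: "w \<in> V - {r}" "\<And>v. v \<in> V - {r} \<Longrightarrow> d w \<le> d v"
    using ex_has_least_nat[of "\<lambda>v. v \<in> V - {r}" _ d] by blast
  have "par w \<in> V" "d (par w) < d w" using T w(1) by (auto simp: spanning_tree_def)
  hence "par w = r" using w(2)[of "par w"] by fastforce
  thus ?thesis using that w(1) by blast
qed

lemma connected_on_tree_edges:
  assumes T: "spanning_tree V E r par d"
  shows "connected_on V (tree_edges V r par)"
proof -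
  have to_root: "(v, r) \<in> (adjacency (tree_edges V r par))\<^sup>*" if "v \<in> V" for v
    using that
  proof (induction "d v" arbitrary: v rule: less_induct)
    case less
    show ?case
    proof (cases "v = r")
      case False
      hence "par v \<in> V" "d (par v) < d v" using T less.prems by (auto simp: spanning_tree_def)
      hence "(par v, r) \<in> (adjacency (tree_edges V r par))\<^sup>*" using less.hyps by blast
      moreover have "(v, par v) \<in> adjacency (tree_edges V r par)"
        using False less.prems by (auto simp: adjacency_def tree_edges_def)
      ultimately show ?thesis by (rule converse_rtrancl_into_rtrancl[rotated])
    qed simp
  qed
  moreover have "(r, v) \<in> (adjacency (tree_edges V r par))\<^sup>*" if "v \<in> V" for v
    using symD[OF sym_rtrancl[OF sym_adjacency] to_root[OF that]] .
  ultimately show ?thesis unfolding connected_on_def by (meson rtrancl_trans)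
qed

lemma adjacency_mono: "E \<subseteq> E' \<Longrightarrow> adjacency E \<subseteq> adjacency E'"
  by (auto simp: adjacency_def)

lemma connected_on_mono: "connected_on V E \<Longrightarrow> E \<subseteq> E' \<Longrightarrow> connected_on V E'"
  unfolding connected_on_def using rtrancl_mono[OF adjacency_mono] by blast

lemma tree_edges_at_leaf:
  assumes "v \<in> V - {r}" and "\<And>w. w \<in> V - {r} \<Longrightarrow> par w \<noteq> v"
  shows "{e \<in> tree_edges V r par. v \<in> e} = {{v, par v}}"
  using assms by (auto simp: tree_edges_def)

lemma deepest_vertex:
  assumes T: "spanning_tree V E r par d" and "card V \<ge> 2"
  obtains v where "v \<in> V - {r}" "\<And>w. w \<in> V - {r} \<Longrightarrow> par w \<noteq> v"
proof -
  have fin: "finite V" using assms(2) by (metis card.infinite not_numeral_le_zero)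
  obtain c where c: "c \<in> V - {r}" "par c = r" using root_has_child[OF assms] by blast
  have max_fin: "finite (d ` V)" "d ` V \<noteq> {}" using fin c by auto
  obtain v where v: "v \<in> V" "d v = Max (d ` V)" using Max_in[OF max_fin] by auto
  have le: "d w \<le> d v" if "w \<in> V" for w using v(2) Max_ge[OF max_fin(1)] that by auto
  have lt: "d (par w) < d w" if "w \<in> V - {r}" for w using T that by (auto simp: spanning_tree_def)
  have "v \<noteq> r" using lt[OF c(1)] le[of c] c by auto
  moreover have "par w \<noteq> v" if "w \<in> V - {r}" for w using lt[OF that] le[of w] that by auto
  ultimately show ?thesis using that v(1) by blast
qed

text \<open>The values vanish from the deepest vertices up to the root. A childless vertex is
  covered by \<open>leaf\<close>. If \<open>v\<close> has a child \<open>w\<close>, every other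
  neighbour of \<open>w\<close> is either a child of \<open>w\<close>, hence deeper than
  \<open>v\<close>, or joined to \<open>w\<close> by a nontree edge. So the equation at
  \<open>w\<close> leaves only the term of \<open>v\<close>, whose coefficient is 1 or -1.\<close>

lemma spanning_tree_forces:
  fixes x :: "'v \<Rightarrow> complex"
  assumes \<Gamma>: "signed_graph \<Gamma>" and T: "spanning_tree (verts \<Gamma>) (edges \<Gamma>) r par d"
    and card: "card (verts \<Gamma>) \<ge> 2"
    and kernel: "\<And>w. w \<in> verts \<Gamma> \<Longrightarrow>
      (\<Sum>u \<in> {u \<in> verts \<Gamma>. {w, u} \<in> edges \<Gamma>}. complex_of_real (sign \<Gamma> {w, u}) * x u) = 0"
    and leaf: "\<And>v. v \<in> verts \<Gamma> - {r} \<Longrightarrow> (\<And>w. w \<in> verts \<Gamma> - {r} \<Longrightarrow> par w \<noteq> v) \<Longrightarrow> x v = 0"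
    and nontree: "\<And>w y. w \<in> verts \<Gamma> - {r} \<Longrightarrow> {w, y} \<in> edges \<Gamma> - tree_edges (verts \<Gamma>) r par \<Longrightarrow> x y = 0"
    and v: "v \<in> verts \<Gamma>"
  shows "x v = 0"
proof -
  let ?V = "verts \<Gamma>" and ?E = "edges \<Gamma>"
  have fin: "finite ?V" using \<Gamma> by (simp add: signed_graph_def)
  have d_le: "d v \<le> Max (d ` ?V)" if "v \<in> ?V" for v using fin that by simp
  show ?thesis using v
  proof (induction "Max (d ` ?V) - d v" arbitrary: v rule: less_induct)
    case less
    show ?case
    proof (cases "\<exists>w \<in> ?V - {r}. par w = v")
      case False
      moreover from this have "v \<noteq> r" using root_has_child[OF T card] by metis
      ultimately show ?thesis using leaf less.prems by blast
    next
      case True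
      then obtain w where w: "w \<in> ?V - {r}" "par w = v" by blast
      have edge: "{w, v} \<in> ?E" and dw: "d v < d w" using T w by (auto simp: spanning_tree_def)
      have other: "x u = 0" if u: "u \<in> ?V" "{w, u} \<in> ?E" "u \<noteq> v" for u
      proof (cases "{w, u} \<in> tree_edges ?V r par")
        case True
        then obtain z where z: "z \<in> ?V - {r}" "{w, u} = {z, par z}" by (auto simp: tree_edges_def)
        \<comment> \<open>The alternative \<open>z = w\<close> would make \<open>u\<close> the
          parent of \<open>w\<close>, which is \<open>v\<close>.\<close>
        have "z = u" "par z = w" using z(2) w(2) u(3) by (auto simp: doubleton_eq_iff)
        hence "d w < d u" using T z(1) by (auto simp: spanning_tree_def)
        thus ?thesis using less.hyps[of u] u(1) dw d_le[OF u(1)] by simp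
      next
        case False
        thus ?thesis using nontree[OF w(1)] u(2) by blast
      qed
      have "0 = (\<Sum>u \<in> {u \<in> ?V. {w, u} \<in> ?E}. complex_of_real (sign \<Gamma> {w, u}) * x u)"
        using kernel w(1) by simp
      also have "\<dots> = (\<Sum>u \<in> {v}. complex_of_real (sign \<Gamma> {w, u}) * x u)"
        using fin less.prems edge other by (intro sum.mono_neutral_right) auto
      finally show ?thesis using \<Gamma> edge by (auto simp: signed_graph_def)
    qed
  qed
qed

text \<open>The asymmetry of \<open>nontree\<close> matters: an edge between two nonroot vertices
  puts both ends into \<open>Z\<close>, but an edge between \<open>r\<close> and some
  \<open>s\<close> puts only \<open>r\<close> there. The strict bound for nonbridges exploits this
  saving.\<close>

lemma nullity_le_card_spanning_tree:
  assumes \<Gamma>: "signed_graph \<Gamma>" and T: "spanning_tree (verts \<Gamma>) (edges \<Gamma>) r par d"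
    and card: "card (verts \<Gamma>) \<ge> 2" and Z: "Z \<subseteq> verts \<Gamma>"
    and leaf: "\<And>v. v \<in> verts \<Gamma> - {r} \<Longrightarrow> (\<And>w. w \<in> verts \<Gamma> - {r} \<Longrightarrow> par w \<noteq> v) \<Longrightarrow> v \<in> Z"
    and nontree: "\<And>w y. w \<in> verts \<Gamma> - {r} \<Longrightarrow> {w, y} \<in> edges \<Gamma> - tree_edges (verts \<Gamma>) r par \<Longrightarrow> y \<in> Z"
  shows "nullity \<Gamma> \<le> card Z"
proof (rule nullity_le_card[OF \<Gamma> Z], intro ballI)
  fix x :: "'a \<Rightarrow> complex" and v
  assume kernel: "\<And>w. w \<in> verts \<Gamma> \<Longrightarrow>
      (\<Sum>u \<in> {u \<in> verts \<Gamma>. {w, u} \<in> edges \<Gamma>}. complex_of_real (sign \<Gamma> {w, u}) * x u) = 0"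
    and Z0: "\<And>z. z \<in> Z \<Longrightarrow> x z = 0" and v: "v \<in> verts \<Gamma>"
  show "x v = 0"
    by (rule spanning_tree_forces[OF \<Gamma> T card kernel _ _ v]) (use leaf nontree Z0 in \<open>auto\<close>)
qed

section \<open>Degrees and nontree edges\<close>

lemma edges_finite: "signed_graph \<Gamma> \<Longrightarrow> finite (edges \<Gamma>)"
  unfolding signed_graph_def by (rule finite_subset[of _ "Pow (verts \<Gamma>)"]) auto

lemma degree_pos:
  assumes \<Gamma>: "signed_graph \<Gamma>" and conn: "connected_on (verts \<Gamma>) (edges \<Gamma>)"
    and card: "card (verts \<Gamma>) \<ge> 2" and v: "v \<in> verts \<Gamma>"
  shows "degree_of \<Gamma> v \<ge> 1"
proof -
  obtain par d where T: "spanning_tree (verts \<Gamma>) (edges \<Gamma>) v par d"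
    using spanning_tree_exists[OF v _ conn] \<Gamma> unfolding signed_graph_def by metis
  obtain w where "w \<in> verts \<Gamma> - {v}" "par w = v" using root_has_child[OF T card] .
  hence "{w, v} \<in> {e \<in> edges \<Gamma>. v \<in> e}" using T by (auto simp: spanning_tree_def)
  hence "card {e \<in> edges \<Gamma>. v \<in> e} > 0" using edges_finite[OF \<Gamma>] by (auto simp: card_gt_0_iff)
  thus ?thesis by (simp add: degree_of_def)
qed

text \<open>The only tree edge at a leaf is the one to its parent. A leaf of degree at least 2
  therefore lies on a nontree edge.\<close>

lemma nontree_edges_at_leaf:
  assumes \<Gamma>: "signed_graph \<Gamma>" and T: "spanning_tree (verts \<Gamma>) (edges \<Gamma>) r par d"
    and v: "v \<in> verts \<Gamma> - {r}" "\<And>w. w \<in> verts \<Gamma> - {r} \<Longrightarrow> par w \<noteq> v"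
  shows "Suc (card {e \<in> edges \<Gamma> - tree_edges (verts \<Gamma>) r par. v \<in> e}) = degree_of \<Gamma> v"
proof -
  let ?t = "tree_edges (verts \<Gamma>) r par"
  have "{e \<in> edges \<Gamma>. v \<in> e} = {e \<in> edges \<Gamma> - ?t. v \<in> e} \<union> {e \<in> ?t. v \<in> e}"
    using tree_edges_subset[OF T] by blast
  moreover have "card ({e \<in> edges \<Gamma> - ?t. v \<in> e} \<union> {e \<in> ?t. v \<in> e})
      = card {e \<in> edges \<Gamma> - ?t. v \<in> e} + card {e \<in> ?t. v \<in> e}"
    using edges_finite[OF \<Gamma>] tree_edges_subset[OF T]
    by (intro card_Un_disjoint) (auto intro: finite_subset)
  moreover have "card {e \<in> ?t. v \<in> e} = 1"
    using tree_edges_at_leaf[of v "verts \<Gamma>" r par] v by simp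
  ultimately show ?thesis by (simp add: degree_of_def)
qed

lemma card_Union_edges_le:
  assumes "signed_graph \<Gamma>" "F \<subseteq> edges \<Gamma>"
  shows "card (\<Union>F) \<le> 2 * card F"
proof -
  have "card (\<Union>F) \<le> (\<Sum>e\<in>F. card e)" by (rule card_Union_le_sum_card)
  also have "\<dots> = (\<Sum>e\<in>F. 2)" using assms by (intro sum.cong) (auto simp: signed_graph_def)
  finally show ?thesis by simp
qed

subsection \<open>Bounds for connected signed graphs\<close>

text \<open>The value of 2c + p for a connected graph, whose number of components is 1.\<close>

definition nullity_bound :: "'v sgraph \<Rightarrow> int" where
  "nullity_bound \<Gamma> = 2 * (int (card (edges \<Gamma>)) - int (card (verts \<Gamma>)) + 1) + int (num_pendant \<Gamma>)"

text \<open>The forcing set consists of the ends of the nontree edges and the pendant vertices: a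
  leaf on no nontree edge has degree 1. A pendant root can be left out of the pendant vertices,
  since only nonroot leaves have to be forced.\<close>

lemma nullity_le_bound:
  assumes \<Gamma>: "signed_graph \<Gamma>" and conn: "connected_on (verts \<Gamma>) (edges \<Gamma>)"
    and card: "card (verts \<Gamma>) \<ge> 2"
  shows "int (nullity \<Gamma>) \<le> nullity_bound \<Gamma>"
    and "num_pendant \<Gamma> > 0 \<Longrightarrow> int (nullity \<Gamma>) < nullity_bound \<Gamma>"
proof -
  let ?V = "verts \<Gamma>" and ?E = "edges \<Gamma>"
  define P where "P = {v \<in> ?V. degree_of \<Gamma> v = 1}"
  have fin: "finite ?V" "finite ?E" and EV: "\<And>e. e \<in> ?E \<Longrightarrow> e \<subseteq> ?V"
    using \<Gamma> edges_finite[OF \<Gamma>] by (auto simp: signed_graph_def)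
  have finP: "finite P" using fin by (simp add: P_def)
  have tree: thesis if "r \<in> ?V" "\<And>par d. spanning_tree ?V ?E r par d \<Longrightarrow> thesis" for r thesis
    using spanning_tree_exists[OF that(1) EV conn] that(2) by blast
  have leaf: "v \<in> P \<union> \<Union>(?E - tree_edges ?V r par)"
    if T: "spanning_tree ?V ?E r par d" and v: "v \<in> ?V - {r}" "\<And>w. w \<in> ?V - {r} \<Longrightarrow> par w \<noteq> v"
    for r par d v
  proof (cases "{e \<in> ?E - tree_edges ?V r par. v \<in> e} = {}")
    case True
    have "Suc (card {e \<in> ?E - tree_edges ?V r par. v \<in> e}) = degree_of \<Gamma> v"
      by (rule nontree_edges_at_leaf[OF \<Gamma> T v])
    thus ?thesis using v(1) unfolding True by (simp add: P_def)
  qed blast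
  show "int (nullity \<Gamma>) \<le> nullity_bound \<Gamma>"
  proof -
    obtain r where "r \<in> ?V" using card by fastforce
    then obtain par d where T: "spanning_tree ?V ?E r par d" by (rule tree)
    define F where "F = ?E - tree_edges ?V r par"
    define Z where "Z = \<Union>F \<union> P"
    have "nullity \<Gamma> \<le> card Z"
    proof (rule nullity_le_card_spanning_tree[OF \<Gamma> T card])
      show "Z \<subseteq> ?V" using EV by (auto simp: Z_def F_def P_def)
    qed (use leaf[OF T] in \<open>auto simp: Z_def F_def\<close>)
    also have "card Z \<le> card (\<Union>F) + card P" unfolding Z_def by (rule card_Un_le)
    also have "\<dots> \<le> 2 * card F + card P"
      using card_Union_edges_le[OF \<Gamma>, of F] by (auto simp: F_def)
    finally show ?thesis
      using card_nontree_edges[OF T fin] by (simp add: nullity_bound_def num_pendant_def P_def F_def)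
  qed
  show "int (nullity \<Gamma>) < nullity_bound \<Gamma>" if "num_pendant \<Gamma> > 0"
  proof -
    have "card P > 0" using that by (simp add: num_pendant_def P_def)
    hence "P \<noteq> {}" by auto
    then obtain r where r: "r \<in> P" by blast
    hence "r \<in> ?V" by (simp add: P_def)
    then obtain par d where T: "spanning_tree ?V ?E r par d" by (rule tree)
    define F where "F = ?E - tree_edges ?V r par"
    define Z where "Z = \<Union>F \<union> (P - {r})"
    obtain w where w: "w \<in> ?V - {r}" "par w = r" using root_has_child[OF T card] .
    \<comment> \<open>The single edge at \<open>r\<close> is the tree edge to its child
      \<open>w\<close>, so no nontree edge meets \<open>r\<close>.\<close>
    have "{w, r} \<in> tree_edges ?V r par" "{w, r} \<in> ?E"
      using w T by (auto simp: tree_edges_def spanning_tree_def)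
    moreover have "card {e \<in> ?E. r \<in> e} = 1" using r by (simp add: P_def degree_of_def)
    then obtain g where g: "{e \<in> ?E. r \<in> e} = {g}" by (rule card_1_singletonE)
    have "e = g" if "e \<in> ?E" "r \<in> e" for e
    proof -
      have "e \<in> {e \<in> ?E. r \<in> e}" using that by simp
      thus ?thesis unfolding g by simp
    qed
    ultimately have "e \<in> tree_edges ?V r par" if "e \<in> ?E" "r \<in> e" for e
      using that by (metis insertI1 insertI2)
    hence rF: "r \<notin> \<Union>F" by (auto simp: F_def)
    have "nullity \<Gamma> \<le> card Z"
    proof (rule nullity_le_card_spanning_tree[OF \<Gamma> T card])
      show "Z \<subseteq> ?V" using EV by (auto simp: Z_def F_def P_def)
    qed (use leaf[OF T] rF in \<open>auto simp: Z_def F_def\<close>)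
    also have "card Z \<le> card (\<Union>F) + card (P - {r})" unfolding Z_def by (rule card_Un_le)
    also have "\<dots> \<le> 2 * card F + card (P - {r})"
      using card_Union_edges_le[OF \<Gamma>, of F] by (auto simp: F_def)
    also have "card (P - {r}) < card P" using card_Diff1_less[OF finP r] .
    finally show ?thesis
      using card_nontree_edges[OF T fin] by (simp add: nullity_bound_def num_pendant_def P_def F_def)
  qed
qed

text \<open>Rooting at the endpoint \<open>r\<close> of the nontree edge \<open>{r, s}\<close> makes the equation at \<open>r\<close>
  superfluous, and this is the only place where the value at \<open>s\<close> enters through that edge.\<close>

lemma nullity_less_if_nonbridge:
  assumes \<Gamma>: "signed_graph \<Gamma>" and card: "card (verts \<Gamma>) \<ge> 2"
    and no_pendant: "\<And>v. v \<in> verts \<Gamma> \<Longrightarrow> degree_of \<Gamma> v \<ge> 2"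
    and rs: "{r, s} \<in> edges \<Gamma>" and conn: "connected_on (verts \<Gamma>) (edges \<Gamma> - {{r, s}})"
    and deg: "degree_of \<Gamma> s \<ge> 3"
  shows "int (nullity \<Gamma>) < nullity_bound \<Gamma>"
proof -
  let ?V = "verts \<Gamma>" and ?E = "edges \<Gamma>" and ?e = "{r, s}"
  have fin: "finite ?V" "finite ?E" and EV: "\<And>e. e \<in> ?E \<Longrightarrow> e \<subseteq> ?V"
    using \<Gamma> edges_finite[OF \<Gamma>] by (auto simp: signed_graph_def)
  have r: "r \<in> ?V" using EV[OF rs] by simp
  \<comment> \<open>The tree lives in the graph without \<open>{r, s}\<close>, which makes
    \<open>{r, s}\<close> a nontree edge at the root.\<close>
  obtain par d where T': "spanning_tree ?V (?E - {?e}) r par d"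
    using spanning_tree_exists[OF r _ conn] EV by blast
  hence T: "spanning_tree ?V ?E r par d" by (auto simp: spanning_tree_def)
  define F where "F = ?E - tree_edges ?V r par"
  have e: "?e \<in> F" using rs tree_edges_subset[OF T'] by (auto simp: F_def)
  have finF: "finite F" using fin by (simp add: F_def)
  \<comment> \<open>The edge \<open>{r, s}\<close> contributes only \<open>r\<close>, every other
    nontree edge at most two vertices, so the size is at most \<open>2 * (card F - 1) + 1\<close>,
    which is less than \<open>2 * card F\<close>.\<close>
  define Z where "Z = insert r (\<Union>(F - {?e}))"
  have "nullity \<Gamma> \<le> card Z"
  proof (rule nullity_le_card_spanning_tree[OF \<Gamma> T card])
    show "Z \<subseteq> ?V" using EV r by (auto simp: Z_def F_def)
  next
    fix v assume v: "v \<in> ?V - {r}" "\<And>w. w \<in> ?V - {r} \<Longrightarrow> par w \<noteq> v"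
    have deg_v: "Suc (card {e \<in> F. v \<in> e}) = degree_of \<Gamma> v"
      unfolding F_def by (rule nontree_edges_at_leaf[OF \<Gamma> T v])
    \<comment> \<open>A leaf still lies on a nontree edge other than \<open>{r, s}\<close>: if it is
      \<open>s\<close>, degree at least 3 gives two nontree edges; any other leaf is not on
      \<open>{r, s}\<close> and has one by degree at least 2.\<close>
    have "\<not> {e \<in> F. v \<in> e} \<subseteq> {?e}"
    proof
      assume sub: "{e \<in> F. v \<in> e} \<subseteq> {?e}"
      show False
      proof (cases "v = s")
        case True
        have "card {e \<in> F. v \<in> e} \<le> card {?e}" using sub by (intro card_mono) auto
        thus False using deg_v deg True by simp
      next
        case False
        hence none: "{e \<in> F. v \<in> e} = {}" using sub v(1) by auto
        show False using deg_v no_pendant[of v] v(1) unfolding none by simp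
      qed
    qed
    thus "v \<in> Z" by (auto simp: Z_def)
  next
    fix w y assume "w \<in> ?V - {r}" "{w, y} \<in> ?E - tree_edges ?V r par"
    \<comment> \<open>If the edge is \<open>{r, s}\<close>, then \<open>w\<close> is
      \<open>s\<close> because it is not the root, and the far end is \<open>r\<close>.\<close>
    thus "y \<in> Z" by (cases "{w, y} = ?e") (auto simp: Z_def F_def doubleton_eq_iff)
  qed
  also have "card Z \<le> Suc (card (\<Union>(F - {?e})))" unfolding Z_def by (rule card_insert_le_m1) auto
  also have "\<dots> \<le> Suc (2 * card (F - {?e}))"
    using card_Union_edges_le[OF \<Gamma>, of "F - {?e}"] by (auto simp: F_def)
  also have "card (F - {?e}) = card F - 1" using e by simp
  finally have "nullity \<Gamma> \<le> Suc (2 * (card F - 1))" .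
  moreover have "card F > 0" using e finF by (auto simp: card_gt_0_iff)
  ultimately show ?thesis
    using card_nontree_edges[OF T fin] by (simp add: nullity_bound_def F_def)
qed

subsection \<open>Cycles\<close>

text \<open>The closing edge stands apart from the path, so that removing it leaves a path between
  its ends.\<close>

definition cycle_in :: "'v set set \<Rightarrow> 'v list \<Rightarrow> bool" where
  "cycle_in E vs \<longleftrightarrow> length vs \<ge> 3 \<and> distinct vs \<and> successively (\<lambda>u v. {u, v} \<in> E) vs \<and>
     {last vs, hd vs} \<in> E"

text \<open>Used to bring a chosen vertex of the cycle to the head, where it becomes an end of the
  closing edge.\<close>

lemma cycle_in_rotate: "cycle_in E (us @ vs) \<Longrightarrow> cycle_in E (vs @ us)"
  by (cases "us = []"; cases "vs = []") (auto simp: cycle_in_def successively_append_iff)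

lemma successively_imp_rtrancl:
  "successively (\<lambda>u v. (u, v) \<in> R) vs \<Longrightarrow> vs \<noteq> [] \<Longrightarrow> (hd vs, last vs) \<in> R\<^sup>*"
proof (induction vs)
  case (Cons v vs)
  show ?case
  proof (cases "vs = []")
    case False
    hence "(v, hd vs) \<in> R" "(hd vs, last vs) \<in> R\<^sup>*" using Cons by (auto simp: successively_Cons)
    thus ?thesis using False by (simp add: converse_rtrancl_into_rtrancl)
  qed simp
qed simp

lemma rtrancl_imp_distinct_path:
  assumes "(a, b) \<in> R\<^sup>*"
  shows "\<exists>vs. vs \<noteq> [] \<and> distinct vs \<and> hd vs = a \<and> last vs = b \<and> successively (\<lambda>u v. (u, v) \<in> R) vs"
  using assms
proof (induction rule: rtrancl_induct)
  case base
  show ?case by (rule exI[of _ "[a]"]) simp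
next
  case (step b c)
  then obtain vs where vs: "vs \<noteq> []" "distinct vs" "hd vs = a" "last vs = b"
    "successively (\<lambda>u v. (u, v) \<in> R) vs" by blast
  show ?case
  proof (cases "c \<in> set vs")
    case False
    thus ?thesis using vs step.hyps by (intro exI[of _ "vs @ [c]"]) (auto simp: successively_append_iff)
  next
    case True
    \<comment> \<open>A path that already visits \<open>c\<close> is cut off there, which keeps it
      distinct.\<close>
    then obtain xs ys where "vs = xs @ c # ys" by (meson split_list)
    thus ?thesis using vs
      by (intro exI[of _ "xs @ [c]"]) (auto simp: successively_append_iff hd_append)
  qed
qed

text \<open>The rest of the cycle is a path that replaces the removed edge.\<close>

lemma connected_on_remove_cycle_edge:
  assumes conn: "connected_on V E" and cyc: "cycle_in E vs"
  shows "connected_on V (E - {{last vs, hd vs}})"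
proof -
  let ?e = "{last vs, hd vs}"
  let ?R = "adjacency (E - {?e})"
  have len: "length vs \<ge> 3" and dist: "distinct vs" and ne: "vs \<noteq> []"
    using cyc by (auto simp: cycle_in_def)
  have "successively (\<lambda>u v. (u, v) \<in> ?R) vs"
    unfolding successively_conv_nth
  proof (intro allI impI)
    fix i assume i: "Suc i < length vs"
    have "{vs ! i, vs ! Suc i} \<in> E"
      using cyc i unfolding cycle_in_def by (auto dest: successively_nth)
    \<comment> \<open>On two vertices the path edge would be the closing edge itself; three distinct
      vertices exclude this.\<close>
    moreover have "{vs ! i, vs ! Suc i} \<noteq> ?e"
      using i len dist ne
      by (auto simp: doubleton_eq_iff last_conv_nth hd_conv_nth nth_eq_iff_index_eq)
    ultimately show "(vs ! i, vs ! Suc i) \<in> ?R" by (simp add: adjacency_def)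
  qed
  hence path: "(hd vs, last vs) \<in> ?R\<^sup>*" using successively_imp_rtrancl[OF _ ne] by blast
  have path': "(last vs, hd vs) \<in> ?R\<^sup>*" by (rule symD[OF sym_rtrancl[OF sym_adjacency] path])
  have "adjacency E \<subseteq> ?R\<^sup>*"
  proof
    fix p assume p: "p \<in> adjacency E"
    obtain x y where xy: "p = (x, y)" by fastforce
    show "p \<in> ?R\<^sup>*"
    proof (cases "{x, y} = ?e")
      case True
      thus ?thesis using path path' xy by (auto simp: doubleton_eq_iff)
    next
      case False
      thus ?thesis using p xy by (auto simp: adjacency_def)
    qed
  qed
  hence "(adjacency E)\<^sup>* \<subseteq> ?R\<^sup>*" by (rule rtrancl_subset_rtrancl)
  thus ?thesis using conn unfolding connected_on_def by blast
qed

text \<open>A deepest vertex of a spanning tree is a leaf of degree at least 2, so it carries a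
  nontree edge. The ends of this edge stay connected without it, and a path between them closes to a
  cycle.\<close>

lemma cycle_in_exists:
  assumes \<Gamma>: "signed_graph \<Gamma>" and conn: "connected_on (verts \<Gamma>) (edges \<Gamma>)"
    and card: "card (verts \<Gamma>) \<ge> 2"
    and deg: "\<And>v. v \<in> verts \<Gamma> \<Longrightarrow> degree_of \<Gamma> v \<ge> 2"
  obtains vs where "cycle_in (edges \<Gamma>) vs"
proof -
  let ?V = "verts \<Gamma>" and ?E = "edges \<Gamma>"
  have EV: "\<And>e. e \<in> ?E \<Longrightarrow> e \<subseteq> ?V \<and> card e = 2" using \<Gamma> by (auto simp: signed_graph_def)
  obtain r where r: "r \<in> ?V" using card by fastforce
  obtain par d where T: "spanning_tree ?V ?E r par d"
    using spanning_tree_exists[OF r _ conn] EV by blast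
  obtain v where v: "v \<in> ?V - {r}" "\<And>w. w \<in> ?V - {r} \<Longrightarrow> par w \<noteq> v"
    using deepest_vertex[OF T card] by blast
  have "Suc (card {e \<in> ?E - tree_edges ?V r par. v \<in> e}) \<ge> 2"
    using nontree_edges_at_leaf[OF \<Gamma> T v] deg[of v] v(1) by simp
  hence "{e \<in> ?E - tree_edges ?V r par. v \<in> e} \<noteq> {}" by (intro notI) (simp only: card.empty)
  then obtain e where e: "e \<in> ?E - tree_edges ?V r par" by blast
  then obtain a b where ab: "e = {a, b}" "a \<noteq> b" using EV by (metis DiffD1 card_2_iff)
  have "a \<in> ?V" "b \<in> ?V" using EV e ab by blast+
  moreover have "connected_on ?V (?E - {e})"
    by (rule connected_on_mono[OF connected_on_tree_edges[OF T]]) (use e tree_edges_subset[OF T] in auto)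
  ultimately have "(a, b) \<in> (adjacency (?E - {e}))\<^sup>*" by (simp add: connected_on_def)
  then obtain vs where vs: "vs \<noteq> []" "distinct vs" "hd vs = a" "last vs = b"
    "successively (\<lambda>u v. (u, v) \<in> adjacency (?E - {e})) vs"
    using rtrancl_imp_distinct_path by metis
  \<comment> \<open>A path on one vertex contradicts \<open>a \<noteq> b\<close>, and one on two
    vertices would use the removed edge \<open>e\<close>.\<close>
  have "length vs \<ge> 3"
  proof (rule ccontr)
    assume "\<not> length vs \<ge> 3"
    then consider "length vs = 0" | "length vs = 1" | "length vs = 2" by linarith
    thus False
    proof cases
      case 3
      then obtain x y where "vs = [x, y]" by (auto simp: numeral_2_eq_2 length_Suc_conv)
      thus False using vs ab by (auto simp: adjacency_def)
    qed (use vs ab in \<open>auto simp: length_Suc_conv\<close>)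
  qed
  moreover have "successively (\<lambda>u v. {u, v} \<in> ?E) vs"
    by (rule successively_mono[OF vs(5)]) (auto simp: adjacency_def)
  moreover have "{last vs, hd vs} \<in> ?E" using vs ab e by (auto simp: insert_commute)
  ultimately show ?thesis using that vs(2) by (auto simp: cycle_in_def)
qed

lemma cycle_edge_pairs:
  assumes len: "length vs \<ge> 3" and dist: "distinct vs"
  shows "inj_on (\<lambda>i. {vs ! i, vs ! (Suc i mod length vs)}) {..<length vs}"
    and "i < length vs \<Longrightarrow> \<exists>j < length vs. j \<noteq> i \<and> Suc j mod length vs = i"
proof -
  let ?n = "length vs"
  show "inj_on (\<lambda>i. {vs ! i, vs ! (Suc i mod ?n)}) {..<?n}"
  proof (rule inj_onI)
    fix i j assume ij: "i \<in> {..<?n}" "j \<in> {..<?n}"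
      "{vs ! i, vs ! (Suc i mod ?n)} = {vs ! j, vs ! (Suc j mod ?n)}"
    have "Suc i mod ?n < ?n" "Suc j mod ?n < ?n" using len by (auto intro!: mod_less_divisor)
    \<comment> \<open>In the second case each index is the cyclic successor of the other, so the
      length would divide 2.\<close>
    hence "i = j \<or> i = Suc j mod ?n \<and> j = Suc i mod ?n"
      using ij dist by (auto simp: doubleton_eq_iff nth_eq_iff_index_eq)
    thus "i = j" using ij len by (auto simp: mod_Suc split: if_splits)
  qed
  assume i: "i < ?n"
  show "\<exists>j < ?n. j \<noteq> i \<and> Suc j mod ?n = i"
  proof (cases i)
    case 0
    have "Suc (?n - 1) = ?n" using len by simp
    thus ?thesis using 0 len by (intro exI[of _ "?n - 1"]) auto
  next
    case (Suc k)
    thus ?thesis using i by (intro exI[of _ k]) auto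
  qed
qed

lemma two_cycle_edges:
  assumes len: "length vs \<ge> 3" and dist: "distinct vs" and v: "v \<in> set vs"
  obtains e f where "e \<noteq> f" "v \<in> e" "v \<in> f"
    "{e, f} \<subseteq> {{vs ! i, vs ! (Suc i mod length vs)} | i. i < length vs}"
proof -
  obtain i where i: "i < length vs" "v = vs ! i" using v by (metis in_set_conv_nth)
  obtain j where j: "j < length vs" "j \<noteq> i" "Suc j mod length vs = i"
    using cycle_edge_pairs(2)[OF len dist i(1)] by blast
  have "{vs ! i, vs ! (Suc i mod length vs)} \<noteq> {vs ! j, vs ! (Suc j mod length vs)}"
    using inj_onD[OF cycle_edge_pairs(1)[OF len dist], of i j] i j by auto
  thus ?thesis using i j by (intro that) auto
qed

text \<open>With these counts \<open>nullity_bound\<close> of a signed cycle is 2, which is where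
  the nullity in the theorem comes from.\<close>

lemma signed_cycle_counts:
  assumes "signed_cycle \<Gamma>"
  shows "card (edges \<Gamma>) = card (verts \<Gamma>)" "num_pendant \<Gamma> = 0"
proof -
  obtain vs where vs: "length vs \<ge> 3" "distinct vs" "verts \<Gamma> = set vs"
    and E: "edges \<Gamma> = {{vs ! i, vs ! (Suc i mod length vs)} | i. i < length vs}"
    using assms by (auto simp: signed_cycle_def)
  have "edges \<Gamma> = (\<lambda>i. {vs ! i, vs ! (Suc i mod length vs)}) ` {..<length vs}" using E by auto
  thus "card (edges \<Gamma>) = card (verts \<Gamma>)"
    using card_image[OF cycle_edge_pairs(1)[OF vs(1,2)]] vs by (simp add: distinct_card)
  have "degree_of \<Gamma> v \<noteq> 1" if v: "v \<in> verts \<Gamma>" for v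
  proof
    assume "degree_of \<Gamma> v = 1"
    then obtain g where g: "{e \<in> edges \<Gamma>. v \<in> e} = {g}"
      unfolding degree_of_def by (rule card_1_singletonE)
    have "v \<in> set vs" using v vs(3) by simp
    from two_cycle_edges[OF vs(1,2) this, folded E]
    obtain e f where ef: "e \<noteq> f" "v \<in> e" "v \<in> f" "{e, f} \<subseteq> edges \<Gamma>" by blast
    hence "{e, f} \<subseteq> {e \<in> edges \<Gamma>. v \<in> e}" by simp
    thus False using ef(1) unfolding g by simp
  qed
  hence none: "{v \<in> verts \<Gamma>. degree_of \<Gamma> v = 1} = {}" by blast
  show "num_pendant \<Gamma> = 0" unfolding num_pendant_def none by simp
qed

text \<open>The two cycle edges at a cycle vertex exhaust its degree, so no further edge leaves the
  cycle, and connectedness leaves nothing outside it.\<close>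

lemma signed_cycle_if_cycle_degrees_2:
  assumes \<Gamma>: "signed_graph \<Gamma>" and conn: "connected_on (verts \<Gamma>) (edges \<Gamma>)"
    and cyc: "cycle_in (edges \<Gamma>) vs"
    and deg: "\<And>v. v \<in> set vs \<Longrightarrow> degree_of \<Gamma> v = 2"
  shows "signed_cycle \<Gamma>"
proof -
  let ?V = "verts \<Gamma>" and ?E = "edges \<Gamma>" and ?n = "length vs"
  define C where "C = {{vs ! i, vs ! (Suc i mod ?n)} | i. i < ?n}"
  have len: "?n \<ge> 3" and dist: "distinct vs" using cyc by (auto simp: cycle_in_def)
  have EV: "\<And>e. e \<in> ?E \<Longrightarrow> e \<subseteq> ?V \<and> card e = 2" using \<Gamma> by (auto simp: signed_graph_def)
  have CE: "C \<subseteq> ?E"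
  proof
    fix e assume "e \<in> C"
    then obtain i where i: "i < ?n" "e = {vs ! i, vs ! (Suc i mod ?n)}" by (auto simp: C_def)
    show "e \<in> ?E"
    proof (cases "Suc i = ?n")
      case True
      have "vs \<noteq> []" using len by auto
      hence "last vs = vs ! i" "hd vs = vs ! 0"
        using True by (auto simp: last_conv_nth hd_conv_nth simp flip: True)
      thus ?thesis using cyc True i(2) by (simp add: cycle_in_def)
    next
      case False
      hence "Suc i < ?n" using i(1) by simp
      thus ?thesis using cyc successively_nth[of "\<lambda>u v. {u, v} \<in> ?E" vs i] i(2) by (simp add: cycle_in_def)
    qed
  qed
  have C_sub: "e \<subseteq> set vs" if "e \<in> C" for e
    using that len by (auto simp: C_def intro!: nth_mem mod_less_divisor)
  have at_cycle: "e \<in> C" if e: "e \<in> ?E" "v \<in> e" "v \<in> set vs" for e v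
  proof -
    obtain f g where fg: "f \<noteq> g" "v \<in> f" "v \<in> g" "{f, g} \<subseteq> C"
      using two_cycle_edges[OF len dist e(3), folded C_def] by blast
    have "{f, g} = {e \<in> ?E. v \<in> e}"
    proof (rule card_subset_eq)
      show "finite {e \<in> ?E. v \<in> e}" using edges_finite[OF \<Gamma>] by simp
      show "{f, g} \<subseteq> {e \<in> ?E. v \<in> e}" using fg(2,3) subset_trans[OF fg(4) CE] by simp
      show "card {f, g} = card {e \<in> ?E. v \<in> e}"
        using deg[OF e(3)] fg(1) by (simp add: degree_of_def)
    qed
    thus ?thesis using e fg(4) by blast
  qed
  have closed: "v \<in> set vs" if "(u, v) \<in> (adjacency ?E)\<^sup>*" "u \<in> set vs" for u v
    using that
  proof (induction rule: rtrancl_induct)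
    case (step y z)
    hence "{y, z} \<in> C" using at_cycle[of "{y, z}" y] by (simp add: adjacency_def)
    thus ?case using C_sub by blast
  qed
  have V: "?V = set vs"
  proof
    have "set vs \<subseteq> \<Union>C"
    proof
      fix v assume "v \<in> set vs"
      from two_cycle_edges[OF len dist this, folded C_def] show "v \<in> \<Union>C" by blast
    qed
    thus "set vs \<subseteq> ?V" using CE EV by blast
    moreover have "vs ! 0 \<in> set vs" using len by (intro nth_mem) linarith
    ultimately show "?V \<subseteq> set vs"
      using conn closed[of "vs ! 0"] unfolding connected_on_def by blast
  qed
  have "?E = C"
  proof
    show "?E \<subseteq> C"
    proof
      fix e assume e: "e \<in> ?E"
      hence "e \<subseteq> ?V" "e \<noteq> {}" using EV[OF e] by auto
      then obtain v where "v \<in> e" "v \<in> set vs" using V by blast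
      thus "e \<in> C" using at_cycle e by blast
    qed
  qed (rule CE)
  thus ?thesis unfolding signed_cycle_def using \<Gamma> len dist V unfolding C_def by blast
qed

text \<open>Equality excludes pendant vertices, so all degrees are at least 2 and there is a cycle.
  A cycle vertex of larger degree would play the part of \<open>s\<close> in
  \<open>nullity_less_if_nonbridge\<close>, with a cycle edge at it as the nonbridge.\<close>

lemma nullity_eq_bound_imp_cycle:
  assumes \<Gamma>: "signed_graph \<Gamma>" and conn: "connected_on (verts \<Gamma>) (edges \<Gamma>)"
    and card: "card (verts \<Gamma>) \<ge> 2" and eq: "int (nullity \<Gamma>) = nullity_bound \<Gamma>"
  shows "signed_cycle \<Gamma>"
proof -
  have "num_pendant \<Gamma> = 0" using nullity_le_bound(2)[OF \<Gamma> conn card] eq by fastforce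
  hence "{v \<in> verts \<Gamma>. degree_of \<Gamma> v = 1} = {}"
    using \<Gamma> by (simp add: num_pendant_def signed_graph_def)
  hence deg: "degree_of \<Gamma> v \<ge> 2" if "v \<in> verts \<Gamma>" for v
    using degree_pos[OF \<Gamma> conn card that] that by force
  obtain vs where cyc: "cycle_in (edges \<Gamma>) vs" using cycle_in_exists[OF \<Gamma> conn card deg] by blast
  have "degree_of \<Gamma> v = 2" if "v \<in> set vs" for v
  proof (rule ccontr)
    assume "degree_of \<Gamma> v \<noteq> 2"
    obtain xs ys where "vs = xs @ v # ys" using split_list[OF \<open>v \<in> set vs\<close>] by blast
    hence cyc': "cycle_in (edges \<Gamma>) ((v # ys) @ xs)" using cyc cycle_in_rotate by blast
    define ws where "ws = (v # ys) @ xs"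
    have ws: "cycle_in (edges \<Gamma>) ws" "hd ws = v" using cyc' by (auto simp: ws_def)
    have e: "{last ws, v} \<in> edges \<Gamma>" using ws by (auto simp: cycle_in_def)
    hence "v \<in> verts \<Gamma>" using \<Gamma> by (auto simp: signed_graph_def)
    hence "degree_of \<Gamma> v \<ge> 3" using deg[of v] \<open>degree_of \<Gamma> v \<noteq> 2\<close> by simp
    moreover have "connected_on (verts \<Gamma>) (edges \<Gamma> - {{last ws, v}})"
      using connected_on_remove_cycle_edge[OF conn ws(1)] ws(2) by simp
    ultimately show False
      using nullity_less_if_nonbridge[OF \<Gamma> card deg e] eq by simp
  qed
  thus ?thesis by (rule signed_cycle_if_cycle_degrees_2[OF \<Gamma> conn cyc])
qed

subsection \<open>Decomposition into components\<close>

lemma equiv_reachable: "equiv (verts \<Gamma>) (reachable \<Gamma>)"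
proof (rule equivI)
  show "reachable \<Gamma> \<subseteq> verts \<Gamma> \<times> verts \<Gamma>" by (auto simp: reachable_def)
  show "refl_on (verts \<Gamma>) (reachable \<Gamma>)" by (auto simp: refl_on_def reachable_def)
  show "sym (reachable \<Gamma>)"
    using sym_rtrancl[OF sym_adjacency[of "edges \<Gamma>"]]
    by (auto simp: sym_def reachable_def adjacency_def)
  show "trans (reachable \<Gamma>)" by (auto simp: trans_def reachable_def intro: rtrancl_trans)
qed

text \<open>Sums run over the vertex sets of the components, to which the lemmas on disjoint unions
  apply; \<open>card_components\<close> passes back to the component graphs.\<close>

locale component_classes =
  fixes \<Gamma> :: "'v sgraph" and \<C> :: "'v set set"
  assumes \<Gamma>: "signed_graph \<Gamma>" and classes: "\<C> = verts \<Gamma> // reachable \<Gamma>"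
begin

lemma finite_verts: "finite (verts \<Gamma>)"
  using \<Gamma> by (simp add: signed_graph_def)

lemma Union_classes: "\<Union>\<C> = verts \<Gamma>"
  unfolding classes by (rule Union_quotient[OF equiv_reachable])

lemma class_subset: "C \<in> \<C> \<Longrightarrow> C \<subseteq> verts \<Gamma>"
  using Union_classes by blast

lemma finite_class: "C \<in> \<C> \<Longrightarrow> finite C"
  using class_subset finite_verts finite_subset by blast

lemma finite_classes: "finite \<C>"
  using class_subset finite_verts by (intro finite_subset[of \<C> "Pow (verts \<Gamma>)"]) auto

lemma class_unique: "C \<in> \<C> \<Longrightarrow> D \<in> \<C> \<Longrightarrow> v \<in> C \<Longrightarrow> v \<in> D \<Longrightarrow> C = D"
  using quotient_disj[OF equiv_reachable, of C \<Gamma> D] unfolding classes by blast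

lemma disjoint_classes: "disjoint \<C>"
  using class_unique by (auto simp: disjoint_def)

lemma class_closed:
  assumes C: "C \<in> \<C>" and "x \<in> C" and e: "{x, y} \<in> edges \<Gamma>"
  shows "y \<in> C"
proof -
  have "x \<in> verts \<Gamma>" "y \<in> verts \<Gamma>" using \<Gamma> e by (auto simp: signed_graph_def)
  hence "(x, y) \<in> reachable \<Gamma>" using e by (auto simp: reachable_def)
  thus ?thesis
    using in_quotient_imp_closed[OF equiv_reachable C[unfolded classes] \<open>x \<in> C\<close>] by blast
qed

lemma edge_subset_class:
  assumes C: "C \<in> \<C>" and "v \<in> C" and e: "e \<in> edges \<Gamma>" "v \<in> e"
  shows "e \<subseteq> C"
proof -
  have "card e = 2" using \<Gamma> e by (simp add: signed_graph_def)
  then obtain w where "e = {v, w}" using e(2) by (auto simp: card_2_iff)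
  thus ?thesis using class_closed[OF C \<open>v \<in> C\<close>] e \<open>v \<in> C\<close> by auto
qed

lemma signed_graph_induced: "C \<in> \<C> \<Longrightarrow> signed_graph (induced \<Gamma> C)"
  using \<Gamma> finite_class by (auto simp: signed_graph_def induced_def)

text \<open>A walk that starts in a class cannot leave it, so all its edges survive in the induced
  graph. For this the induction carries membership in \<open>C\<close> along.\<close>

lemma connected_on_class:
  assumes C: "C \<in> \<C>"
  shows "connected_on (verts (induced \<Gamma> C)) (edges (induced \<Gamma> C))"
  unfolding connected_on_def
proof (intro ballI)
  fix u v assume "u \<in> verts (induced \<Gamma> C)" "v \<in> verts (induced \<Gamma> C)"
  hence u: "u \<in> C" and v: "v \<in> C" by (auto simp: induced_def)
  have "(u, v) \<in> reachable \<Gamma>"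
    by (rule in_quotient_imp_in_rel[OF equiv_reachable C[unfolded classes]]) (use u v in auto)
  hence "(u, v) \<in> (adjacency (edges \<Gamma>))\<^sup>*" by (simp add: reachable_def adjacency_def)
  hence "v \<in> C \<and> (u, v) \<in> (adjacency (edges (induced \<Gamma> C)))\<^sup>*"
  proof (induction rule: rtrancl_induct)
    case base
    show ?case using u by simp
  next
    case (step y z)
    have "{y, z} \<in> edges \<Gamma>" using step.hyps(2) by (simp add: adjacency_def)
    moreover have "z \<in> C" using class_closed[OF C] step.IH calculation by blast
    ultimately have "(y, z) \<in> adjacency (edges (induced \<Gamma> C))"
      using step.IH by (simp add: adjacency_def induced_def)
    thus ?case using step.IH \<open>z \<in> C\<close> by (meson rtrancl_into_rtrancl)
  qed
  thus "(u, v) \<in> (adjacency (edges (induced \<Gamma> C)))\<^sup>*" ..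
qed

lemma degree_induced:
  assumes C: "C \<in> \<C>" "v \<in> C"
  shows "degree_of (induced \<Gamma> C) v = degree_of \<Gamma> v"
proof -
  have "{e \<in> edges (induced \<Gamma> C). v \<in> e} = {e \<in> edges \<Gamma>. v \<in> e}"
    using edge_subset_class[OF C] by (auto simp: induced_def)
  thus ?thesis by (simp add: degree_of_def)
qed

lemma nullity_sum: "nullity \<Gamma> = (\<Sum>C\<in>\<C>. nullity (induced \<Gamma> C))"
proof -
  have "{e \<in> edges \<Gamma>. e \<subseteq> verts \<Gamma>} = edges \<Gamma>" using \<Gamma> by (auto simp: signed_graph_def)
  hence "induced \<Gamma> (verts \<Gamma>) = \<Gamma>" by (simp add: induced_def)
  moreover have "nullity (induced \<Gamma> (\<Union>\<C>)) = (\<Sum>C\<in>\<C>. nullity (induced \<Gamma> C))"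
    by (rule nullity_induced_Union[OF finite_classes finite_class disjoint_classes])
      (use class_closed class_unique in blast)+
  ultimately show ?thesis by (simp add: Union_classes)
qed

lemma card_components: "card (components \<Gamma>) = card \<C>"
  unfolding components_def classes[symmetric]
  by (rule card_image, rule inj_onI) (metis induced_def sgraph.select_convs(1))

lemma card_verts_sum: "card (verts \<Gamma>) = (\<Sum>C\<in>\<C>. card (verts (induced \<Gamma> C)))"
proof -
  have "card (\<Union>\<C>) = (\<Sum>C\<in>\<C>. card C)"
    by (rule card_Union_disjoint[OF disjoint_classes finite_class])
  thus ?thesis by (simp add: Union_classes induced_def)
qed

lemma card_edges_sum: "card (edges \<Gamma>) = (\<Sum>C\<in>\<C>. card (edges (induced \<Gamma> C)))"
proof -
  have "edges \<Gamma> \<subseteq> (\<Union>C\<in>\<C>. edges (induced \<Gamma> C))"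
  proof
    fix e assume e: "e \<in> edges \<Gamma>"
    hence "e \<subseteq> verts \<Gamma>" "card e = 2" using \<Gamma> by (auto simp: signed_graph_def)
    then obtain v where "v \<in> e" "v \<in> verts \<Gamma>" by (auto simp: card_2_iff)
    then obtain C where "C \<in> \<C>" "v \<in> C" using Union_classes by blast
    thus "e \<in> (\<Union>C\<in>\<C>. edges (induced \<Gamma> C))"
      using edge_subset_class[of C v e] e \<open>v \<in> e\<close> by (auto simp: induced_def)
  qed
  hence E: "edges \<Gamma> = (\<Union>C\<in>\<C>. edges (induced \<Gamma> C))" by (auto simp: induced_def)
  have "edges (induced \<Gamma> C) \<inter> edges (induced \<Gamma> D) = {}" if "C \<in> \<C>" "D \<in> \<C>" "C \<noteq> D" for C D
  proof (rule ccontr)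
    assume "edges (induced \<Gamma> C) \<inter> edges (induced \<Gamma> D) \<noteq> {}"
    then obtain e where e: "e \<in> edges \<Gamma>" "e \<subseteq> C" "e \<subseteq> D" by (auto simp: induced_def)
    have "card e = 2" using \<Gamma> e(1) by (simp add: signed_graph_def)
    hence "e \<noteq> {}" by auto
    thus False using e class_unique that by blast
  qed
  thus ?thesis unfolding E using finite_classes edges_finite[OF signed_graph_induced]
    by (intro card_UN_disjoint) auto
qed

lemma num_pendant_sum: "num_pendant \<Gamma> = (\<Sum>C\<in>\<C>. num_pendant (induced \<Gamma> C))"
proof -
  let ?P = "\<lambda>C. {v \<in> C. degree_of \<Gamma> v = 1}"
  have "{v \<in> verts \<Gamma>. degree_of \<Gamma> v = 1} = (\<Union>C\<in>\<C>. ?P C)" using Union_classes by blast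
  hence "num_pendant \<Gamma> = card (\<Union>C\<in>\<C>. ?P C)" by (simp add: num_pendant_def)
  also have "\<dots> = (\<Sum>C\<in>\<C>. card (?P C))"
  proof (rule card_UN_disjoint[OF finite_classes])
    show "\<forall>C\<in>\<C>. finite (?P C)" using finite_class by simp
    show "\<forall>C\<in>\<C>. \<forall>D\<in>\<C>. C \<noteq> D \<longrightarrow> ?P C \<inter> ?P D = {}" using class_unique by blast
  qed
  also have "\<dots> = (\<Sum>C\<in>\<C>. num_pendant (induced \<Gamma> C))"
  proof (rule sum.cong[OF refl])
    fix C assume C: "C \<in> \<C>"
    have "?P C = {v \<in> verts (induced \<Gamma> C). degree_of (induced \<Gamma> C) v = 1}"
      using degree_induced[OF C] by (auto simp: induced_def)
    thus "card (?P C) = num_pendant (induced \<Gamma> C)" by (simp only: num_pendant_def)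
  qed
  finally show ?thesis .
qed

text \<open>The summands 1 in the single bounds add up to the number of components in
  \<open>cyclomatic\<close>.\<close>

lemma nullity_bound_sum:
  "2 * cyclomatic \<Gamma> + int (num_pendant \<Gamma>) = (\<Sum>C\<in>\<C>. nullity_bound (induced \<Gamma> C))"
  unfolding cyclomatic_def nullity_bound_def card_components card_verts_sum card_edges_sum
    num_pendant_sum
  by (simp add: sum.distrib sum_subtractf sum_distrib_left[symmetric])

end

theorem theorem5p1:
  fixes \<Gamma> :: "'v sgraph"
  assumes "signed_graph \<Gamma>"
    and "\<forall>\<Delta> \<in> components \<Gamma>. card (verts \<Delta>) \<ge> 2"
  shows "int (nullity \<Gamma>) = 2 * cyclomatic \<Gamma> + int (num_pendant \<Gamma>) \<longleftrightarrow>
    (\<forall>\<Delta> \<in> components \<Gamma>. signed_cycle \<Delta> \<and> nullity \<Delta> = 2)"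
proof -
  define \<C> where "\<C> = verts \<Gamma> // reachable \<Gamma>"
  interpret component_classes \<Gamma> \<C> by unfold_locales (simp_all add: assms(1) \<C>_def)
  have components: "components \<Gamma> = induced \<Gamma> ` \<C>" by (simp add: components_def \<C>_def)
  have card: "card (verts (induced \<Gamma> C)) \<ge> 2" if "C \<in> \<C>" for C
    using assms(2) that unfolding components by simp
  have le: "int (nullity (induced \<Gamma> C)) \<le> nullity_bound (induced \<Gamma> C)" if "C \<in> \<C>" for C
    by (rule nullity_le_bound(1)[OF signed_graph_induced connected_on_class card]) (rule that)+
  have eq_iff: "int (nullity (induced \<Gamma> C)) = nullity_bound (induced \<Gamma> C)
      \<longleftrightarrow> signed_cycle (induced \<Gamma> C) \<and> nullity (induced \<Gamma> C) = 2" if C: "C \<in> \<C>" for C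
  proof -
    have "signed_cycle (induced \<Gamma> C)" if "int (nullity (induced \<Gamma> C)) = nullity_bound (induced \<Gamma> C)"
      by (rule nullity_eq_bound_imp_cycle[OF signed_graph_induced connected_on_class card that])
        (rule C)+
    moreover have "nullity_bound (induced \<Gamma> C) = 2" if "signed_cycle (induced \<Gamma> C)"
      using signed_cycle_counts[OF that] by (simp add: nullity_bound_def)
    ultimately show ?thesis by auto
  qed
  \<comment> \<open>By \<open>le\<close> each component has nonnegative slack, so the total slack is
    0 exactly when every single one is.\<close>
  have "int (nullity \<Gamma>) = 2 * cyclomatic \<Gamma> + int (num_pendant \<Gamma>) \<longleftrightarrow>
      (\<Sum>C\<in>\<C>. nullity_bound (induced \<Gamma> C) - int (nullity (induced \<Gamma> C))) = 0"
    unfolding nullity_bound_sum nullity_sum by (auto simp: sum_subtractf)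
  also have "\<dots> \<longleftrightarrow> (\<forall>C\<in>\<C>. nullity_bound (induced \<Gamma> C) - int (nullity (induced \<Gamma> C)) = 0)"
    by (rule sum_nonneg_eq_0_iff[OF finite_classes]) (use le in simp)
  also have "\<dots> \<longleftrightarrow> (\<forall>C\<in>\<C>. signed_cycle (induced \<Gamma> C) \<and> nullity (induced \<Gamma> C) = 2)"
    using eq_iff by (metis eq_iff_diff_eq_0)
  finally show ?thesis by (simp add: components)
qed

end
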